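(* \[ d_{\rm BM}^+\big( C[0,\omega], C([0,\omega] \times 2)\big) >3 .\]
   Context: $[0,\omega]$ is the space of ordinals $\le\omega$ with the order topology (a convergent sequence with its limit $\omega$), and $2=\{0,1\}$ is discrete. For a compact Hausdorff space $K$, $C(K)$ is the Banach space of real-valued continuous functions on $K$ with the supremum norm. An isomorphism between Banach spaces is a bounded linear bijection with bounded inverse. An isomorphism $T:C(K)\to C(L)$ is positive if $Tf\ge 0$ whenever $f\ge 0$. The (one-sided) positive Banach--Mazur distance $d_{\rm BM}^+\big(C(K),C(L)\big)$ is the infimum of $\|T\|\cdot\|T^{-1}\|$ over all positive isomorphisms $T:C(K)\to C(L)$. The inverse $T^{-1}$ is not required to be positive, and in general $d_{\rm BM}^+\big(C(K),C(L)\big)\ne d_{\rm BM}^+\big(C(L),C(K)\big)$. *)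

theory Defs
  imports "HOL-Analysis.Analysis"
begin

text \<open>
  For a compact Hausdorff space \<open>K\<close>, given as a type \<open>'k\<close>, the Banach space \<open>C(K)\<close> is the library
  type \<open>'k \<Rightarrow>\<^sub>C real\<close> of bounded continuous functions with the supremum norm. On a compact space
  boundedness is automatic, so this type consists of all continuous functions:
\<close>

lemma continuous_imp_bcontfun:
  fixes f :: "'k::topological_space \<Rightarrow> real"
  assumes "compact (UNIV :: 'k set)" and "continuous_on UNIV f"
  shows "f \<in> bcontfun"
  using assms by (auto simp: bcontfun_def intro: compact_imp_bounded compact_continuous_image)

definition Banach_isomorphism :: "('a::real_normed_vector \<Rightarrow> 'b::real_normed_vector) \<Rightarrow> bool"
  where "Banach_isomorphism T \<longleftrightarrow> bounded_linear T \<and> bij T \<and> bounded_linear (inv T)"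

definition positive_operator ::
    "(('k::topological_space \<Rightarrow>\<^sub>C real) \<Rightarrow> ('l::topological_space \<Rightarrow>\<^sub>C real)) \<Rightarrow> bool"
  where "positive_operator T \<longleftrightarrow>
    (\<forall>f. (\<forall>x. 0 \<le> apply_bcontfun f x) \<longrightarrow> (\<forall>y. 0 \<le> apply_bcontfun (T f) y))"

text \<open>
  The two type arguments stand for the compact spaces \<open>K\<close> and \<open>L\<close>. The infimum is taken in the
  extended reals, so it is \<open>\<infinity>\<close> if there is no positive isomorphism from \<open>C(K)\<close> to \<open>C(L)\<close>.
\<close>

definition positive_BM_distance ::
    "'k::topological_space itself \<Rightarrow> 'l::topological_space itself \<Rightarrow> ereal"
  where "positive_BM_distance K L =
    (INF T \<in> {T :: ('k \<Rightarrow>\<^sub>C real) \<Rightarrow> ('l \<Rightarrow>\<^sub>C real). Banach_isomorphism T \<and> positive_operator T}.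
       ereal (onorm T * onorm (inv T)))"

text \<open>
  The ordinal space \<open>[0,\<omega>]\<close> is the type \<open>enat\<close>, with \<open>\<infinity>\<close> in the role of \<open>\<omega>\<close>: its library topology
  is the order topology. The space \<open>2\<close> is \<open>bool\<close>, whose library topology is discrete. Both spaces in
  question are compact Hausdorff:
\<close>

lemma compact_UNIV_enat: "compact (UNIV :: enat set)"
  by (rule compact_UNIV)

lemma compact_UNIV_enat_bool: "compact (UNIV :: (enat \<times> bool) set)"
  using compact_Times[OF compact_UNIV_enat finite_imp_compact[of "UNIV :: bool set"]]
  by simp

end

theory Submission
  imports Defs
begin

text \<open>
  Write \<open>\<omega>\<close> for the limit point of \<open>[0,\<omega>]\<close> and scale a positive isomorphism \<open>T\<close> so that its
  inverse \<open>R\<close> is a contraction; then \<open>M = \<parallel>T\<parallel>\<close> has to be bounded below. The functional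
  \<open>f \<mapsto> T f (\<omega>, b)\<close> is a positive measure \<open>\<mu>\<^sub>b\<close> of mass at most \<open>M\<close>. Let \<open>\<alpha>\<^sub>b\<close> be its mass on a small
  neighbourhood of \<open>\<omega>\<close> and \<open>\<sigma>\<^sub>b\<close> its remainder.

  The number 3 comes from flipping a sign. Take \<open>h\<close> in the unit ball with \<open>h (\<omega>, b) = -1\<close>, and put
  \<open>f = R h\<close>. Raising \<open>h\<close> to \<open>1\<close> at the single point \<open>(n, b)\<close> keeps it in the unit ball, and for large
  \<open>n\<close> changes \<open>f\<close> very little on any given finite set, because \<open>R\<close> maps the indicators of these points
  to a pointwise null sequence. The measures at \<open>(n, b)\<close> converge to \<open>\<mu>\<^sub>b\<close>, so away from \<open>\<omega>\<close> they
  still see \<open>\<sigma>\<^sub>b(f) = -1 - \<alpha>\<^sub>b f(\<omega>)\<close>, although the total must now be \<open>1\<close>. The mass near \<open>\<omega>\<close> makes up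
  the difference: \<open>\<alpha>\<^sub>b \<ge> 2 + \<alpha>\<^sub>b f(\<omega>)\<close>, while \<open>\<parallel>\<sigma>\<^sub>b\<parallel> \<ge> 1 + \<alpha>\<^sub>b f(\<omega>)\<close>, up to small errors
  (\<open>mass_estimates\<close>). If \<open>h\<close> takes opposite values \<open>\<plusminus>1\<close> at the two limit points, this applies to
  \<open>h\<close> and to \<open>-h\<close>, so one of the two signs of \<open>f(\<omega>)\<close> is favourable, and
  for the corresponding \<open>b\<close> adding the two bounds gives \<open>M \<ge> 3 + 2 \<alpha>\<^sub>b \<bar>f(\<omega>)\<bar>\<close> with \<open>\<alpha>\<^sub>b \<ge> 2\<close>, again up
  to small errors.

  If \<open>M\<close> is close to 3, then \<open>f(\<omega>)\<close> is close to \<open>0\<close> for \<^emph>\<open>every\<close> such \<open>h\<close>, and the masses are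
  close to \<open>\<alpha>\<^sub>b = 2\<close> and \<open>\<parallel>\<sigma>\<^sub>b\<parallel> = 1\<close> (\<open>values_at_infinity\<close>). The first fact says that evaluation at
  \<open>\<omega>\<close> nearly vanishes on the common kernel of \<open>\<mu>\<^sub>0\<close> and \<open>\<mu>\<^sub>1\<close>, since adding a small function that
  vanishes at both limit points to a suitable \<open>h\<close> keeps it admissible. By the second fact, the
  function with value \<open>1\<close> near \<open>\<omega>\<close> and \<open>-2\<close> elsewhere nearly lies in this kernel, yet its value at
  \<open>\<omega>\<close> is \<open>1\<close>. This contradiction has quantitative room and gives \<open>M \<ge> 3 + 1/100\<close>
  (\<open>distortion_lower_bound\<close>).
\<close>

section \<open>Continuous functions on the two spaces\<close>

lemma continuous_on_enat_eventually_const: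
  fixes f :: "enat \<Rightarrow> 'a::topological_space"
  assumes "\<And>k. N \<le> k \<Longrightarrow> f (enat k) = f \<infinity>"
  shows "continuous_on UNIV f"
proof -
  have "open (f -` B)" for B
  proof -
    have "{enat N<..} \<subseteq> f -` B" if "\<infinity> \<in> f -` B"
    proof
      fix x assume "x \<in> {enat N<..}"
      then show "x \<in> f -` B" using that assms by (cases x) auto
    qed
    then show ?thesis unfolding open_enat_iff by blast
  qed
  then show ?thesis by (simp add: continuous_on_open_vimage)
qed

lemma tendsto_enat_infinity: "enat \<longlonglongrightarrow> \<infinity>"
proof (rule topological_tendstoI)
  fix S :: "enat set" assume "open S" "\<infinity> \<in> S"
  then obtain n :: nat where "{enat n<..} \<subseteq> S" by (auto simp: open_enat_iff)
  then show "\<forall>\<^sub>F k in sequentially. enat k \<in> S"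
    by (intro eventually_sequentiallyI[of "Suc n"]) auto
qed

lemma bcontfun_tendsto_infinity:
  fixes f :: "enat \<Rightarrow>\<^sub>C real"
  shows "(\<lambda>n. f (enat n)) \<longlonglongrightarrow> f \<infinity>"
  using continuous_on_tendsto_compose[OF continuous_on_apply_bcontfun[of UNIV f] tendsto_enat_infinity]
  by simp

lemma bcontfun_tendsto_infinity_pair:
  fixes g :: "(enat \<times> bool) \<Rightarrow>\<^sub>C real"
  shows "(\<lambda>n. g (enat n, b)) \<longlonglongrightarrow> g (\<infinity>, b)"
  using continuous_on_tendsto_compose[OF continuous_on_apply_bcontfun[of UNIV g]
      tendsto_Pair[OF tendsto_enat_infinity tendsto_const]]
  by simp

lemma abs_apply_le_norm:
  fixes f :: "'a::topological_space \<Rightarrow>\<^sub>C real"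
  shows "\<bar>f x\<bar> \<le> norm f"
  using norm_bounded[of f x] by simp

lemma norm_le_iff_abs_apply_le:
  fixes f :: "'a::topological_space \<Rightarrow>\<^sub>C real"
  shows "norm f \<le> c \<longleftrightarrow> (\<forall>x. \<bar>f x\<bar> \<le> c)"
  by (metis abs_apply_le_norm norm_bound order_trans real_norm_def)

lemma norm_const_one: "norm (const_bcontfun 1 :: 'a::topological_space \<Rightarrow>\<^sub>C real) = 1"
proof (rule antisym)
  show "norm (const_bcontfun 1 :: 'a \<Rightarrow>\<^sub>C real) \<le> 1"
    by (simp add: norm_le_iff_abs_apply_le)
  show "1 \<le> norm (const_bcontfun 1 :: 'a \<Rightarrow>\<^sub>C real)"
    using abs_apply_le_norm[of "const_bcontfun 1 :: 'a \<Rightarrow>\<^sub>C real" undefined]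
    by (simp)
qed

definition tail_indicator :: "nat \<Rightarrow> enat \<Rightarrow>\<^sub>C real"
  where "tail_indicator N = Bcontfun (\<lambda>k. if enat N \<le> k then 1 else 0)"

definition truncation :: "nat \<Rightarrow> (enat \<Rightarrow>\<^sub>C real) \<Rightarrow> (enat \<Rightarrow>\<^sub>C real)"
  where "truncation N f = Bcontfun (\<lambda>k. if enat N \<le> k then 0 else f k)"

definition point_indicator :: "nat \<Rightarrow> bool \<Rightarrow> (enat \<times> bool) \<Rightarrow>\<^sub>C real"
  where "point_indicator n b = Bcontfun (\<lambda>y. if y = (enat n, b) then 1 else 0)"

lemma apply_tail_indicator: "tail_indicator N k = (if enat N \<le> k then 1 else 0)"
  unfolding tail_indicator_def
  by (subst Bcontfun_inverse)
     (auto intro!: continuous_imp_bcontfun compact_UNIV_enat continuous_on_enat_eventually_const[of N])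

lemma apply_truncation: "truncation N f k = (if enat N \<le> k then 0 else f k)"
  unfolding truncation_def
  by (subst Bcontfun_inverse)
     (auto intro!: continuous_imp_bcontfun compact_UNIV_enat continuous_on_enat_eventually_const[of N])

lemma continuous_on_snd_discrete:
  fixes h :: "bool \<Rightarrow> real"
  shows "continuous_on UNIV (\<lambda>y :: enat \<times> bool. h (snd y))"
  by (rule continuous_on_compose2[of UNIV h]) (auto intro!: continuous_intros)

lemma apply_point_indicator: "point_indicator n b y = (if y = (enat n, b) then 1 else 0)"
proof -
  have 1: "continuous_on UNIV (\<lambda>y :: enat \<times> bool. if fst y = enat n then 1 else 0 :: real)"
    by (rule continuous_on_compose2[of UNIV "\<lambda>k. if k = enat n then 1 else 0"])
       (auto intro!: continuous_intros continuous_on_enat_eventually_const[of "Suc n"])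
  have 2: "continuous_on UNIV (\<lambda>y :: enat \<times> bool. if snd y = b then 1 else 0 :: real)"
    by (rule continuous_on_snd_discrete)
  have eq: "(\<lambda>y :: enat \<times> bool. if y = (enat n, b) then 1 else 0 :: real)
      = (\<lambda>y. (if fst y = enat n then 1 else 0) * (if snd y = b then 1 else 0))"
    by (auto simp: fun_eq_iff)
  have "continuous_on UNIV (\<lambda>y :: enat \<times> bool. if y = (enat n, b) then 1 else 0 :: real)"
    unfolding eq by (rule continuous_on_mult[OF 1 2])
  then show ?thesis
    unfolding point_indicator_def
    by (subst Bcontfun_inverse) (auto intro!: continuous_imp_bcontfun compact_UNIV_enat_bool)
qed

section \<open>Normalised positive isomorphisms\<close>

text \<open>
  Distortion is invariant under scaling \<open>T\<close>, so the inverse \<open>R\<close> may be assumed contractive; \<open>M\<close> then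
  bounds the distortion. Contractivity of \<open>R\<close> is the form in which the inverse enters: it turns any
  \<open>h\<close> in the unit ball of the target into an \<open>f\<close> in the unit ball with \<open>T f = h\<close>.
\<close>

locale normalized_positive_isomorphism =
  fixes T :: "(enat \<Rightarrow>\<^sub>C real) \<Rightarrow> ((enat \<times> bool) \<Rightarrow>\<^sub>C real)"
    and R :: "((enat \<times> bool) \<Rightarrow>\<^sub>C real) \<Rightarrow> (enat \<Rightarrow>\<^sub>C real)"
    and M :: real
  assumes linear_T: "linear T" and linear_R: "linear R"
    and T_R: "T (R h) = h" and R_T: "R (T f) = f"
    and positive: "positive_operator T"
    and norm_T: "norm (T f) \<le> M * norm f"
    and norm_R: "norm (R h) \<le> norm h"
begin

lemmas T_simps = linear_add[OF linear_T] linear_diff[OF linear_T] linear_scale[OF linear_T]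
  linear_neg[OF linear_T]
lemmas R_simps = linear_add[OF linear_R] linear_diff[OF linear_R] linear_scale[OF linear_R]
  linear_neg[OF linear_R]

lemma T_mono:
  fixes f g :: "enat \<Rightarrow>\<^sub>C real"
  assumes "\<And>k. f k \<le> g k"
  shows "T f y \<le> T g y"
proof -
  have "\<forall>k. 0 \<le> (g - f) k" using assms by simp
  then have "0 \<le> T (g - f) y" using positive unfolding positive_operator_def by blast
  then show ?thesis by (simp add: T_simps)
qed

lemma T_one_le: "T (const_bcontfun 1) y \<le> M"
  using abs_apply_le_norm[of "T (const_bcontfun 1)" y] norm_T[of "const_bcontfun 1"]
  by (simp add: norm_const_one)

lemma M_ge_1: "1 \<le> M"
  using norm_R[of "T (const_bcontfun 1)"] norm_T[of "const_bcontfun 1"]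
  unfolding R_T norm_const_one by linarith

text \<open>
  Signed sums of indicators of distinct points have norm at most \<open>1\<close>, so choosing the signs of the
  values \<open>R (point_indicator n b) k\<close> shows that these values are absolutely summable over \<open>n\<close>.
\<close>

lemma R_point_indicator_tendsto_0: "(\<lambda>n. R (point_indicator n b) k) \<longlonglongrightarrow> 0"
proof -
  have "(\<Sum>n<m. \<bar>R (point_indicator n b) k\<bar>) \<le> 1" for m
  proof -
    define s where "s n = sgn (R (point_indicator n b) k)" for n
    define g where "g = (\<Sum>n<m. s n *\<^sub>R point_indicator n b)"
    have g: "g y = (\<Sum>n<m. s n * point_indicator n b y)" for y
      unfolding g_def by (induction m) auto
    have "\<bar>g y\<bar> \<le> 1" for y
    proof (cases "\<exists>j<m. y = (enat j, b)")
      case True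
      then obtain j where j: "j < m" "y = (enat j, b)" by blast
      have "g y = (\<Sum>n<m. if n = j then s j else 0)"
        unfolding g by (intro sum.cong) (auto simp: j apply_point_indicator)
      then show ?thesis using j by (simp add: s_def sgn_if)
    next
      case False
      then have "g y = 0"
        unfolding g by (intro sum.neutral) (auto simp: apply_point_indicator)
      then show ?thesis by simp
    qed
    then have "norm g \<le> 1" unfolding norm_le_iff_abs_apply_le by blast
    then have "norm (R g) \<le> 1" using norm_R[of g] by linarith
    moreover have "R g k = (\<Sum>n<m. \<bar>R (point_indicator n b) k\<bar>)"
    proof -
      have "R g = (\<Sum>n<m. s n *\<^sub>R R (point_indicator n b))"
        by (simp add: g_def linear_sum[OF linear_R] R_simps)
      moreover have "(\<Sum>n<m. s n *\<^sub>R R (point_indicator n b)) k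
          = (\<Sum>n<m. s n * R (point_indicator n b) k)"
        by (induction m) auto
      ultimately show ?thesis by (simp add: s_def abs_sgn mult.commute)
    qed
    ultimately show ?thesis using abs_apply_le_norm[of "R g" k] by simp
  qed
  then have "summable (\<lambda>n. \<bar>R (point_indicator n b) k\<bar>)"
    by (intro summableI_nonneg_bounded) auto
  then show ?thesis
    by (rule summable_LIMSEQ_zero[OF summable_rabs_cancel])
qed

section \<open>Mass near the limit points\<close>

text \<open>
  This is the sign flip: near \<open>\<infinity>\<close> the function \<open>f = R h\<close> is almost constant, so \<open>h (\<infinity>, b) = -1\<close> fixes the
  contribution to \<open>T f (\<infinity>, b)\<close> of the part \<open>z\<close> of \<open>f\<close> below \<open>N\<close>. The second estimate holds because
  \<open>z \<ge> -1\<close>. For the first, \<open>h\<close> is changed to \<open>1\<close> at a point \<open>(n, b)\<close> far out: below \<open>N\<close> the preimage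
  still looks like \<open>z\<close>, and from \<open>N\<close> on it is at most \<open>1\<close>, so only the mass of the tail can bring
  the value up to \<open>1\<close>.
\<close>

lemma mass_estimates:
  fixes h :: "(enat \<times> bool) \<Rightarrow>\<^sub>C real"
  assumes h: "norm h \<le> 1" "h (\<infinity>, b) = -1" and "0 < e"
  shows "\<forall>\<^sub>F N in sequentially.
    2 - e \<le> T (tail_indicator N) (\<infinity>, b) * (1 - R h \<infinity>) \<and>
    1 - e \<le> T (const_bcontfun 1 - tail_indicator N) (\<infinity>, b) - T (tail_indicator N) (\<infinity>, b) * R h \<infinity>"
proof -
  define f where "f = R h"
  \<comment> \<open>The errors below add up to three times \<open>M * d\<close> (one from replacing \<open>f\<close> by its limit on the
     tail, two from the changed preimage below \<open>N\<close>) and two times \<open>d\<close> (from passing to \<open>(n, b)\<close>).\<close>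
  define d where "d = e / (3 * M + 2)"
  have d: "0 < d" "(3 * M + 2) * d = e" using \<open>0 < e\<close> M_ge_1 by (auto simp: d_def)
  have Md: "M * d \<le> e" "0 \<le> M * d" using d M_ge_1 by (auto simp: algebra_simps)
  have norm_f: "norm f \<le> 1" using norm_R[of h] h by (simp add: f_def)
  have f_le: "\<bar>f k\<bar> \<le> 1" for k using abs_apply_le_norm[of f k] norm_f by simp
  obtain N0 where "\<forall>k\<ge>N0. \<bar>f (enat k) - f \<infinity>\<bar> < d"
    using LIMSEQ_D[OF bcontfun_tendsto_infinity d(1), of f] by auto
  then have "\<forall>\<^sub>F N in sequentially. \<forall>k\<ge>N. \<bar>f (enat k) - f \<infinity>\<bar> < d"
    by (intro eventually_sequentiallyI[of N0]) auto
  then show ?thesis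
  proof (rule eventually_mono)
    fix N assume N: "\<forall>k\<ge>N. \<bar>f (enat k) - f \<infinity>\<bar> < d"
    define w where "w = tail_indicator N"
    define z where "z = truncation N f"
    define o1 :: "enat \<Rightarrow>\<^sub>C real" where "o1 = const_bcontfun 1"
    have o1: "o1 k = 1" for k by (simp add: o1_def)
    have w: "w k = (if enat N \<le> k then 1 else 0)" for k by (simp add: w_def apply_tail_indicator)
    have z: "z k = (if enat N \<le> k then 0 else f k)" for k by (simp add: z_def apply_truncation)
    have Tf: "T f = h" by (simp add: f_def T_R)
    have "T (f \<infinity> *\<^sub>R w + z - d *\<^sub>R o1) (\<infinity>, b) \<le> T f (\<infinity>, b)"
    proof (rule T_mono)
      fix k
      have "f \<infinity> - d \<le> f k" if "enat N \<le> k" using that N d(1) by (cases k) (auto simp: abs_less_iff)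
      then show "(f \<infinity> *\<^sub>R w + z - d *\<^sub>R o1) k \<le> f k"
        using d(1) by (simp add: w z o1)
    qed
    then have "f \<infinity> * T w (\<infinity>, b) + T z (\<infinity>, b) - d * T o1 (\<infinity>, b) \<le> -1"
      by (simp add: T_simps Tf h)
    moreover have "d * T o1 y \<le> M * d" for y
      using T_one_le[of y] d(1) by (simp add: o1_def mult.commute)
    ultimately have Tz: "T z (\<infinity>, b) \<le> -1 - f \<infinity> * T w (\<infinity>, b) + M * d"
      by (smt (verit))
    have "T (- (o1 - w)) (\<infinity>, b) \<le> T z (\<infinity>, b)"
    proof (rule T_mono)
      fix k show "(- (o1 - w)) k \<le> z k" using f_le[of k] by (auto simp: w z o1 abs_le_iff)
    qed
    then have "- T (o1 - w) (\<infinity>, b) \<le> T z (\<infinity>, b)"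
      by (simp only: T_simps) simp
    then have second: "1 - e \<le> T (o1 - w) (\<infinity>, b) - T w (\<infinity>, b) * f \<infinity>"
      using Tz Md by (simp add: mult.commute)
    have ev: "\<forall>\<^sub>F n in sequentially. (\<forall>k\<in>{..<N}. \<bar>R (point_indicator n b) (enat k)\<bar> < d)
        \<and> T w (enat n, b) < T w (\<infinity>, b) + d \<and> T z (enat n, b) < T z (\<infinity>, b) + d"
    proof (intro eventually_conj eventually_ball_finite ballI)
      fix k show "\<forall>\<^sub>F n in sequentially. \<bar>R (point_indicator n b) (enat k)\<bar> < d"
        using tendstoD[OF R_point_indicator_tendsto_0 d(1)] by (simp add: dist_real_def)
    next
      show "\<forall>\<^sub>F n in sequentially. T w (enat n, b) < T w (\<infinity>, b) + d"
        by (rule order_tendstoD(2)[OF bcontfun_tendsto_infinity_pair]) (use d in simp)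
      show "\<forall>\<^sub>F n in sequentially. T z (enat n, b) < T z (\<infinity>, b) + d"
        by (rule order_tendstoD(2)[OF bcontfun_tendsto_infinity_pair]) (use d in simp)
    qed auto
    obtain n where n: "\<And>k. k < N \<Longrightarrow> \<bar>R (point_indicator n b) (enat k)\<bar> < d"
        "T w (enat n, b) < T w (\<infinity>, b) + d" "T z (enat n, b) < T z (\<infinity>, b) + d"
      using eventually_happens'[OF sequentially_bot ev] unfolding Ball_def lessThan_iff by blast
    define c where "c = 1 - h (enat n, b)"
    define h' where "h' = h + c *\<^sub>R point_indicator n b"
    define f' where "f' = R h'"
    have h_le: "\<bar>h y\<bar> \<le> 1" for y using abs_apply_le_norm[of h y] h by simp
    have c: "0 \<le> c" "c \<le> 2" using h_le[of "(enat n, b)"] unfolding c_def by linarith+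
    have h': "h' y = (if y = (enat n, b) then 1 else h y)" for y
      by (simp add: h'_def c_def apply_point_indicator)
    have "\<bar>h' y\<bar> \<le> 1" for y using h_le[of y] by (simp add: h')
    then have "norm h' \<le> 1" unfolding norm_le_iff_abs_apply_le by blast
    then have "norm f' \<le> 1" using norm_R[of h'] by (simp add: f'_def)
    then have f'_le: "f' k \<le> 1" for k using abs_apply_le_norm[of f' k] by simp
    have f': "f' k = f k + c * R (point_indicator n b) k" for k
      by (simp add: f'_def h'_def f_def R_simps)
    have "T f' (enat n, b) \<le> T (w + z + (2 * d) *\<^sub>R o1) (enat n, b)"
    proof (rule T_mono)
      fix k :: enat
      show "f' k \<le> (w + z + (2 * d) *\<^sub>R o1) k"
      proof (cases "enat N \<le> k")
        case True
        then show ?thesis using f'_le[of k] d(1) by (simp add: w z o1)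
      next
        case False
        then obtain j where j: "k = enat j" "j < N" by (cases k) auto
        have "R (point_indicator n b) k \<le> d" using n(1)[OF j(2)] unfolding j(1) by linarith
        then have "c * R (point_indicator n b) k \<le> c * d" using c(1) by (rule mult_left_mono)
        also have "\<dots> \<le> 2 * d" using c(2) d(1) by simp
        finally show ?thesis using False by (simp add: w z o1 f')
      qed
    qed
    moreover have "T f' (enat n, b) = 1"
      by (simp add: f'_def T_R h')
    ultimately have "1 \<le> T w (enat n, b) + T z (enat n, b) + 2 * (d * T o1 (enat n, b))"
      by (simp add: T_simps)
    also have "\<dots> \<le> (T w (\<infinity>, b) + d) + (-1 - f \<infinity> * T w (\<infinity>, b) + M * d + d) + 2 * (M * d)"
      using n(2,3) Tz \<open>\<And>y. d * T o1 y \<le> M * d\<close>[of "(enat n, b)"] by linarith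
    finally have first: "2 - e \<le> T w (\<infinity>, b) * (1 - f \<infinity>)"
      unfolding d(2)[symmetric] by argo
    from first second show "2 - e \<le> T (tail_indicator N) (\<infinity>, b) * (1 - R h \<infinity>) \<and>
      1 - e \<le> T (const_bcontfun 1 - tail_indicator N) (\<infinity>, b) - T (tail_indicator N) (\<infinity>, b) * R h \<infinity>"
      unfolding w_def o1_def f_def by (rule conjI)
  qed
qed

section \<open>Operators of distortion close to 3\<close>

text \<open>
  Adding the two mass estimates for one \<open>b\<close> gives \<open>M \<ge> 3 - d + 2 * (A * (sg b * x))\<close>, where \<open>A\<close> is
  the tail mass and \<open>x = R h \<infinity>\<close>. The sign \<open>sg b\<close> appears because the side \<open>False\<close> is handled by
  \<open>- h\<close>; the two signs together bound \<open>x\<close> from above and from below. With \<open>x\<close> small, the estimates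
  force the tail mass and the remaining mass to be nearly \<open>2\<close> and \<open>1\<close>.
\<close>

lemma values_at_infinity:
  fixes h :: "(enat \<times> bool) \<Rightarrow>\<^sub>C real"
  assumes M: "M < 3 + d" and d: "0 < d" "d \<le> 1 / 10"
    and h: "norm h \<le> 1" "h (\<infinity>, True) = -1" "h (\<infinity>, False) = 1"
  shows "\<bar>R h \<infinity>\<bar> \<le> d"
    and "\<forall>\<^sub>F N in sequentially. \<forall>b.
      \<bar>T (tail_indicator N) (\<infinity>, b) - 2 * T (const_bcontfun 1 - tail_indicator N) (\<infinity>, b)\<bar> \<le> 17 * d"
proof -
  define sg where "sg b = (if b then 1 else -1 :: real)" for b
  define x where "x = R h \<infinity>"
  define A where "A N b = T (tail_indicator N) (\<infinity>, b)" for N b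
  define B where "B N b = T (const_bcontfun 1 - tail_indicator N) (\<infinity>, b)" for N b
  have R_neg: "R (- h) \<infinity> = - x" by (simp add: R_simps x_def)
  have "\<forall>\<^sub>F N in sequentially. 2 - d / 2 \<le> A N b * (1 - sg b * x) \<and> 1 - d / 2 \<le> B N b - A N b * (sg b * x)" for b
    using mass_estimates[of h True "d / 2"] mass_estimates[of "- h" False "d / 2"] h d
    by (cases b) (simp_all add: R_neg A_def B_def sg_def flip: x_def)
  then have ev: "\<forall>\<^sub>F N in sequentially. \<forall>b. 2 - d / 2 \<le> A N b * (1 - sg b * x) \<and> 1 - d / 2 \<le> B N b - A N b * (sg b * x)"
    by (simp add: eventually_all_finite)
  have AB: "0 \<le> A N b" "A N b \<le> A N b + B N b" "A N b + B N b \<le> M" for N b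
  proof -
    have "T 0 (\<infinity>, b) \<le> A N b" unfolding A_def
      by (rule T_mono) (simp add: apply_tail_indicator)
    then show "0 \<le> A N b" by (simp add: linear_0[OF linear_T])
    have "T 0 (\<infinity>, b) \<le> B N b" unfolding B_def
      by (rule T_mono) (simp add: apply_tail_indicator)
    then show "A N b \<le> A N b + B N b" by (simp add: linear_0[OF linear_T])
    show "A N b + B N b \<le> M"
      using T_one_le[of "(\<infinity>, b)"] by (simp add: A_def B_def T_simps)
  qed
  have one_sided: "sg b * x \<le> d"
    if N: "2 - d / 2 \<le> A N b * (1 - sg b * x)" "1 - d / 2 \<le> B N b - A N b * (sg b * x)" for N b
  proof (rule ccontr)
    assume "\<not> sg b * x \<le> d"
    then have pos: "d < sg b * x" by simp
    have "0 \<le> A N b * (sg b * x)" using AB(1)[of N b] pos d by simp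
    then have "1 \<le> A N b" using N(1) d by (simp add: algebra_simps)
    then have "d < A N b * (sg b * x)" using pos d mult_mono[of 1 "A N b" "sg b * x" "sg b * x"] by simp
    then show False using N AB(3)[of N b] M by (simp add: algebra_simps)
  qed
  obtain N where "\<forall>b. 2 - d / 2 \<le> A N b * (1 - sg b * x) \<and> 1 - d / 2 \<le> B N b - A N b * (sg b * x)"
    using eventually_happens[OF ev] by auto
  then have "sg True * x \<le> d" "sg False * x \<le> d" using one_sided by blast+
  then have x: "\<bar>x\<bar> \<le> d" by (simp add: sg_def)
  then show "\<bar>R h \<infinity>\<bar> \<le> d" by (simp add: x_def)
  have "\<bar>A N b - 2 * B N b\<bar> \<le> 17 * d"
    if N: "2 - d / 2 \<le> A N b * (1 - sg b * x)" "1 - d / 2 \<le> B N b - A N b * (sg b * x)" for N b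
  proof -
    have "\<bar>A N b * (sg b * x)\<bar> = A N b * \<bar>x\<bar>" using AB(1)[of N b] by (auto simp: abs_mult sg_def)
    also have "\<dots> \<le> 4 * d" using AB[of N b] x M d by (intro mult_mono) auto
    finally show ?thesis using N AB(3)[of N b] M d by (simp add: algebra_simps abs_le_iff)
  qed
  then show "\<forall>\<^sub>F N in sequentially. \<forall>b.
      \<bar>T (tail_indicator N) (\<infinity>, b) - 2 * T (const_bcontfun 1 - tail_indicator N) (\<infinity>, b)\<bar> \<le> 17 * d"
    using ev unfolding A_def B_def by (auto elim: eventually_mono)
qed

text \<open>
  The value \<open>d = 1/100\<close> is small enough because the argument yields \<open>(1 - 17 * d) / 10 \<le> d\<close>, that is,
  \<open>1 \<le> 27 * d\<close>.
\<close>

lemma distortion_lower_bound: "3 + 1 / 100 \<le> M"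
proof (rule ccontr)
  assume "\<not> 3 + 1 / 100 \<le> M"
  then have M: "M < 3 + 1 / 100" by simp
  define h :: "(enat \<times> bool) \<Rightarrow>\<^sub>C real" where "h = Bcontfun (\<lambda>y. if snd y then -1 else 1)"
  have h: "h y = (if snd y then -1 else 1)" for y
    unfolding h_def
    by (subst Bcontfun_inverse)
       (auto intro!: continuous_imp_bcontfun compact_UNIV_enat_bool
         continuous_on_snd_discrete[of "\<lambda>b. if b then -1 else 1"])
  have "norm h \<le> 1" by (simp add: norm_le_iff_abs_apply_le h)
  from eventually_happens[OF values_at_infinity(2)[OF M _ _ this]]
  obtain N where N: "\<And>b. \<bar>T (tail_indicator N) (\<infinity>, b)
      - 2 * T (const_bcontfun 1 - tail_indicator N) (\<infinity>, b)\<bar> \<le> 17 / 100"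
    by (auto simp: h)
  define u where "u = tail_indicator N - 2 *\<^sub>R (const_bcontfun 1 - tail_indicator N)"
  have u_le: "norm u \<le> 2"
    by (simp add: norm_le_iff_abs_apply_le u_def apply_tail_indicator)
  have u_inf: "u \<infinity> = 1"
    by (simp add: u_def apply_tail_indicator)
  have Tu: "\<bar>T u (\<infinity>, b)\<bar> \<le> 17 / 100" for b
    using N[of b] by (simp add: u_def T_simps)
  define g :: "(enat \<times> bool) \<Rightarrow>\<^sub>C real" where "g = Bcontfun (\<lambda>y. T u (\<infinity>, snd y))"
  have g: "g y = T u (\<infinity>, snd y)" for y
    unfolding g_def
    by (subst Bcontfun_inverse)
       (auto intro!: continuous_imp_bcontfun compact_UNIV_enat_bool
         continuous_on_snd_discrete[of "\<lambda>b. T u (\<infinity>, b)"])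
  have "norm g \<le> 17 / 100" using Tu unfolding norm_le_iff_abs_apply_le by (simp only: g) blast
  then have Rg: "norm (R g) \<le> 17 / 100" using norm_R[of g] by simp
  \<comment> \<open>Subtracting \<open>R g\<close> makes the image vanish at both limit points. The factor \<open>1/10\<close> brings the
     image of a function of norm at most 3 into the unit ball.\<close>
  define v where "v = (1 / 10) *\<^sub>R T (u - R g)"
  have "norm (u - R g) \<le> 3" using norm_triangle_ineq4[of u "R g"] u_le Rg by simp
  then have "norm (T (u - R g)) \<le> 10"
    using norm_T[of "u - R g"] M M_ge_1 mult_mono[of M "301/100" "norm (u - R g)" 3] by simp
  then have "norm v \<le> 1" by (simp add: v_def)
  then have v_le: "\<bar>v y\<bar> \<le> 1" for y using abs_apply_le_norm[of v y] by simp
  have v_inf: "v (\<infinity>, b) = 0" for b by (simp add: v_def T_simps T_R g)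
  \<comment> \<open>The factor \<open>1 - \<bar>v\<bar>\<close> leaves room to add \<open>v\<close> and \<open>-v\<close> without leaving the unit ball. It is \<open>1\<close> at
     the limit points, so \<open>p + v\<close> and \<open>p - v\<close> keep the values of \<open>h\<close> there.\<close>
  define p :: "(enat \<times> bool) \<Rightarrow>\<^sub>C real" where "p = Bcontfun (\<lambda>y. h y * (1 - \<bar>v y\<bar>))"
  have p: "p y = h y * (1 - \<bar>v y\<bar>)" for y
    unfolding p_def
    by (subst Bcontfun_inverse)
       (auto intro!: continuous_imp_bcontfun compact_UNIV_enat_bool continuous_intros)
  have pv: "\<bar>p y + v y\<bar> \<le> 1" "\<bar>p y - v y\<bar> \<le> 1" for y
  proof -
    have "p y = 1 - \<bar>v y\<bar> \<or> p y = \<bar>v y\<bar> - 1" by (simp add: p h)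
    then show "\<bar>p y + v y\<bar> \<le> 1" "\<bar>p y - v y\<bar> \<le> 1" using v_le[of y] by linarith+
  qed
  have "\<bar>R (p + v) \<infinity>\<bar> \<le> 1 / 100"
  proof (rule values_at_infinity(1)[OF M])
    show "norm (p + v) \<le> 1" using pv by (simp add: norm_le_iff_abs_apply_le)
  qed (simp_all add: p h v_inf)
  moreover have "\<bar>R (p - v) \<infinity>\<bar> \<le> 1 / 100"
  proof (rule values_at_infinity(1)[OF M])
    show "norm (p - v) \<le> 1" using pv by (simp add: norm_le_iff_abs_apply_le)
  qed (simp_all add: p h v_inf)
  ultimately have "\<bar>R v \<infinity>\<bar> \<le> 1 / 100"
    unfolding R_simps plus_bcontfun.rep_eq minus_bcontfun.rep_eq by linarith
  moreover have "R v \<infinity> = (1 - R g \<infinity>) / 10"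
    by (simp add: v_def R_simps R_T u_inf)
  moreover have "\<bar>R g \<infinity>\<bar> \<le> 17 / 100" using abs_apply_le_norm[of "R g" \<infinity>] Rg by simp
  ultimately show False by simp
qed

end

section \<open>The distance\<close>

lemma positive_isomorphism_distortion_bound:
  fixes T :: "(enat \<Rightarrow>\<^sub>C real) \<Rightarrow> ((enat \<times> bool) \<Rightarrow>\<^sub>C real)"
  assumes "Banach_isomorphism T" "positive_operator T"
  shows "3 + 1 / 100 \<le> onorm T * onorm (inv T)"
proof -
  have bl: "bounded_linear T" "bounded_linear (inv T)" and "bij T"
    using assms by (auto simp: Banach_isomorphism_def)
  define c where "c = onorm (inv T)"
  have T_inv: "T (inv T h) = h" "inv T (T f) = f" for h f
    using \<open>bij T\<close> by (simp_all add: bij_is_inj bij_is_surj surj_f_inv_f)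
  have "c \<noteq> 0"
  proof
    assume "c = 0"
    then have "norm (inv T (T (const_bcontfun 1))) \<le> 0"
      using onorm[OF bl(2), of "T (const_bcontfun 1)"] by (simp add: c_def)
    then have "const_bcontfun 1 = (0 :: enat \<Rightarrow>\<^sub>C real)" by (simp add: T_inv)
    then show False
      using norm_const_one[where 'a = enat] by simp
  qed
  then have c: "0 < c" using onorm_pos_le[OF bl(2)] by (simp add: c_def)
  interpret normalized_positive_isomorphism
    "\<lambda>f. c *\<^sub>R T f" "\<lambda>h. (1 / c) *\<^sub>R inv T h" "onorm T * c"
  proof
    interpret T: bounded_linear T by (rule bl)
    interpret Ti: bounded_linear "inv T" by (rule bl)
    show "c *\<^sub>R T (f + g) = c *\<^sub>R T f + c *\<^sub>R T g" for f g
      by (simp add: T.add scaleR_add_right)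
    show "c *\<^sub>R T (r *\<^sub>R f) = r *\<^sub>R c *\<^sub>R T f" for r f
      by (simp add: T.scaleR)
    show "(1 / c) *\<^sub>R inv T (f + g) = (1 / c) *\<^sub>R inv T f + (1 / c) *\<^sub>R inv T g" for f g
      by (simp add: Ti.add scaleR_add_right)
    show "(1 / c) *\<^sub>R inv T (r *\<^sub>R f) = r *\<^sub>R (1 / c) *\<^sub>R inv T f" for r f
      by (simp add: Ti.scaleR)
    show "c *\<^sub>R T ((1 / c) *\<^sub>R inv T h) = h" for h
      using c by (simp add: T.scaleR T_inv)
    show "(1 / c) *\<^sub>R inv T (c *\<^sub>R T f) = f" for f
      using c by (simp add: Ti.scaleR T_inv)
    show "positive_operator (\<lambda>f. c *\<^sub>R T f)"
      using assms(2) c by (simp add: positive_operator_def)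
    show "norm (c *\<^sub>R T f) \<le> onorm T * c * norm f" for f
      using onorm[OF bl(1), of f] c by (simp add: mult.commute mult.left_commute)
    show "norm ((1 / c) *\<^sub>R inv T h) \<le> norm h" for h
      using onorm[OF bl(2), of h] c by (simp add: c_def field_simps)
  qed
  show ?thesis using distortion_lower_bound by (simp add: c_def)
qed

theorem corollary5p1:
  shows "positive_BM_distance TYPE(enat) TYPE(enat \<times> bool) > 3"
proof -
  have "ereal (3 + 1 / 100) \<le> positive_BM_distance TYPE(enat) TYPE(enat \<times> bool)"
    unfolding positive_BM_distance_def
    by (intro INF_greatest) (simp only: mem_Collect_eq ereal_less_eq positive_isomorphism_distortion_bound)
  moreover have "(3 :: ereal) < ereal (3 + 1 / 100)" by simp
  ultimately show ?thesis by (rule less_le_trans[rotated])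
qed

end
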